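(* Let $I=\mathbb{2}$, and let $\mathcal{A}$ be the $2$-category generated by objects $X,A,B$; morphisms $\alpha_0\colon X\to A$, $\alpha_1\colon X\to B$ and $f\colon A\to B$; and an invertible $2$-morphism $\alpha\colon f\alpha_0\Rightarrow\alpha_1$. Consider the $2$-functor $f\colon\mathbb{2}\to\mathcal{A}$ given by the morphism $f\colon A\to B$, and let $\mathrm{id}_f\colon\Delta A\Rightarrow f$ be the cone with components $\mathrm{id}_A\colon A\to A$ and $f\colon A\to B$ and with $2$-morphism component $\mathrm{id}_f$. Then $(A,\mathrm{id}_f)$ is $2$-terminal in the pseudo-slice of lax-cones (resp. pseudo-cones) over $f$, but it is not a lax-limit (resp. pseudo-limit) of $f$.
   Context: $\mathbb{2}$ is the category $\{0\to1\}$, regarded as a $2$-category with only identity $2$-morphisms. $2$-categories and $2$-functors are strict; $*$ denotes horizontal composition (and whiskering) of $2$-morphisms and juxtaposition denotes vertical composition. "Generated by the data" means the $2$-category freely generated by the listed objects, morphisms and $2$-morphisms (with a formal inverse adjoined for each $2$-morphism declared invertible). A lax-natural transformation $\mu\colon F\Rightarrow G$ between $2$-functors $F,G\colon I\to\mathcal{A}$ consists of morphisms $\mu_i\colon Fi\to Gi$ for $i\in I$ and $2$-morphisms $\mu_f\colon(Gf)\mu_i\Rightarrow\mu_j(Ff)$ for $f\colon i\to j$ in $I$, such that $\mu_{\mathrm{id}_i}=\mathrm{id}_{\mu_i}$, $\mu_{gf}=(\mu_g*Ff)(Gg*\mu_f)$ for composable $f,g$, and $\mu_g(G\alpha*\mu_i)=(\mu_j*F\alpha)\mu_f$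 for every $2$-morphism $\alpha\colon f\Rightarrow g$ in $I$. It is pseudo-natural if every $\mu_f$ is invertible. A modification $\varphi\colon\mu\to\nu$ consists of $2$-morphisms $\varphi_i\colon\mu_i\Rightarrow\nu_i$ with $\nu_f(Gf*\varphi_i)=(\varphi_j*Ff)\mu_f$ for every $f\colon i\to j$. $\mathrm{Lax}[I,\mathcal{A}]$ (resp. $\mathrm{Ps}[I,\mathcal{A}]$) is the $2$-category of $2$-functors, lax- (resp. pseudo-) natural transformations and modifications. $\Delta X$ is the constant $2$-functor at $X$; a lax-cone (resp. pseudo-cone) over $F$ is a lax- (resp. pseudo-) natural transformation $\Delta X\Rightarrow F$. A lax-limit (resp. pseudo-limit) of $F$ is a pair $(L,\lambda)$ with $\lambda\colon\Delta L\Rightarrow F$ a lax-cone (resp. pseudo-cone) such that for each $X\in\mathcal{A}$ the functor $\lambda_*\circ\Delta\colon\mathcal{A}(X,L)\to\mathrm{Lax}[I,\mathcal{A}](\Delta X,F)$ (resp. $\mathcal{A}(X,L)\to\mathrm{Ps}[I,\mathcal{A}](\Delta X,F)$), given by post-composition with $\lambda$, is an isomorphism of categories. The pseudo-slice of lax-cones (resp. pseudo-cones) over $F$ is the $2$-category whose objects are pairs $(X,\mu)$ with $\mu\colon\Delta X\Rightarrow F$ a lax-cone (resp. pseudo-cone); morphisms $(X,\mu)\to(Y,\nu)$ are pairs $(h,\varphi)$ of a morphism $h\colon X\to Y$ in $\mathcal{A}$ and an invertible modification $\varphi\colon\nu\Delta h\to\mu$; $2$-morphisms $(h,\varphi)\Rightarrow(k,\psi)$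 are $2$-morphisms $\beta\colon h\Rightarrow k$ in $\mathcal{A}$ with $\psi(\nu*\Delta\beta)=\varphi$. An object $L$ of a $2$-category $\mathcal{B}$ is $2$-terminal if for all $X\in\mathcal{B}$ the category $\mathcal{B}(X,L)$ is isomorphic to the terminal category $\mathbb{1}$. *)

theory Defs
  imports "HOL-Library.FuncSet"
begin

section \<open>Categories, functors, isomorphism of categories\<close>

record ('o, 'm) cat =
  Ob :: "'o set"
  Ar :: "'m set"
  dm :: "'m \<Rightarrow> 'o"
  cd :: "'m \<Rightarrow> 'o"
  ident :: "'o \<Rightarrow> 'm"
  cmp :: "'m \<Rightarrow> 'm \<Rightarrow> 'm"

definition is_functor ::
  "('o, 'm) cat \<Rightarrow> ('p, 'n) cat \<Rightarrow> ('o \<Rightarrow> 'p) \<Rightarrow> ('m \<Rightarrow> 'n) \<Rightarrow> bool" where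
  "is_functor C D Fo Fm \<longleftrightarrow>
     (\<forall>x \<in> Ob C. Fo x \<in> Ob D) \<and>
     (\<forall>f \<in> Ar C. Fm f \<in> Ar D \<and> dm D (Fm f) = Fo (dm C f) \<and> cd D (Fm f) = Fo (cd C f)) \<and>
     (\<forall>x \<in> Ob C. Fm (ident C x) = ident D (Fo x)) \<and>
     (\<forall>g \<in> Ar C. \<forall>f \<in> Ar C. dm C g = cd C f \<longrightarrow> Fm (cmp C g f) = cmp D (Fm g) (Fm f))"

definition is_cat_iso ::
  "('o, 'm) cat \<Rightarrow> ('p, 'n) cat \<Rightarrow> ('o \<Rightarrow> 'p) \<Rightarrow> ('m \<Rightarrow> 'n) \<Rightarrow> bool" where
  "is_cat_iso C D Fo Fm \<longleftrightarrow> is_functor C D Fo Fm \<and>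
     (\<exists>Go Gm. is_functor D C Go Gm \<and>
        (\<forall>x \<in> Ob C. Go (Fo x) = x) \<and> (\<forall>f \<in> Ar C. Gm (Fm f) = f) \<and>
        (\<forall>y \<in> Ob D. Fo (Go y) = y) \<and> (\<forall>g \<in> Ar D. Fm (Gm g) = g))"

definition isomorphic_cats :: "('o, 'm) cat \<Rightarrow> ('p, 'n) cat \<Rightarrow> bool" where
  "isomorphic_cats C D \<longleftrightarrow> (\<exists>Fo Fm. is_cat_iso C D Fo Fm)"

definition terminal_cat :: "(unit, unit) cat" where
  "terminal_cat = \<lparr>Ob = UNIV, Ar = UNIV, dm = (\<lambda>_. ()), cd = (\<lambda>_. ()),
     ident = (\<lambda>_. ()), cmp = (\<lambda>_ _. ())\<rparr>"

section \<open>Strict 2-categories\<close>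

text \<open>Composites are written in the order of function application:
  \<open>g \<cdot> f\<close> means first \<open>f\<close>, then \<open>g\<close>, and likewise for the vertical composite \<open>b \<bullet> a\<close>
  and the horizontal composite \<open>b \<star> a\<close>.\<close>

record ('o, 'm, 't) two_cat =
  Obj :: "'o set"
  Mor :: "'m set"
  Cell :: "'t set"
  dom1 :: "'m \<Rightarrow> 'o"
  cod1 :: "'m \<Rightarrow> 'o"
  dom2 :: "'t \<Rightarrow> 'm"
  cod2 :: "'t \<Rightarrow> 'm"
  id1 :: "'o \<Rightarrow> 'm"
  comp1 :: "'m \<Rightarrow> 'm \<Rightarrow> 'm" (infixl "\<cdot>\<index>" 75)
  id2 :: "'m \<Rightarrow> 't"
  vcomp :: "'t \<Rightarrow> 't \<Rightarrow> 't" (infixl "\<bullet>\<index>" 70)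
  hcomp :: "'t \<Rightarrow> 't \<Rightarrow> 't" (infixl "\<star>\<index>" 75)

locale two_category =
  fixes A :: "('o, 'm, 't) two_cat" (structure)
  assumes dom1_Obj: "f \<in> Mor A \<Longrightarrow> dom1 A f \<in> Obj A"
    and cod1_Obj: "f \<in> Mor A \<Longrightarrow> cod1 A f \<in> Obj A"
    and id1_Mor: "x \<in> Obj A \<Longrightarrow> id1 A x \<in> Mor A"
    and dom1_id1: "x \<in> Obj A \<Longrightarrow> dom1 A (id1 A x) = x"
    and cod1_id1: "x \<in> Obj A \<Longrightarrow> cod1 A (id1 A x) = x"
    and comp1_Mor: "\<lbrakk>g \<in> Mor A; f \<in> Mor A; dom1 A g = cod1 A f\<rbrakk> \<Longrightarrow> g \<cdot> f \<in> Mor A"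
    and dom1_comp1: "\<lbrakk>g \<in> Mor A; f \<in> Mor A; dom1 A g = cod1 A f\<rbrakk> \<Longrightarrow> dom1 A (g \<cdot> f) = dom1 A f"
    and cod1_comp1: "\<lbrakk>g \<in> Mor A; f \<in> Mor A; dom1 A g = cod1 A f\<rbrakk> \<Longrightarrow> cod1 A (g \<cdot> f) = cod1 A g"
    and comp1_id1_left: "f \<in> Mor A \<Longrightarrow> id1 A (cod1 A f) \<cdot> f = f"
    and comp1_id1_right: "f \<in> Mor A \<Longrightarrow> f \<cdot> id1 A (dom1 A f) = f"
    and comp1_assoc: "\<lbrakk>h \<in> Mor A; g \<in> Mor A; f \<in> Mor A; dom1 A h = cod1 A g; dom1 A g = cod1 A f\<rbrakk>
          \<Longrightarrow> h \<cdot> g \<cdot> f = h \<cdot> (g \<cdot> f)"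
    and dom2_Mor: "a \<in> Cell A \<Longrightarrow> dom2 A a \<in> Mor A"
    and cod2_Mor: "a \<in> Cell A \<Longrightarrow> cod2 A a \<in> Mor A"
    and dom1_cod2: "a \<in> Cell A \<Longrightarrow> dom1 A (cod2 A a) = dom1 A (dom2 A a)"
    and cod1_cod2: "a \<in> Cell A \<Longrightarrow> cod1 A (cod2 A a) = cod1 A (dom2 A a)"
    and id2_Cell: "f \<in> Mor A \<Longrightarrow> id2 A f \<in> Cell A"
    and dom2_id2: "f \<in> Mor A \<Longrightarrow> dom2 A (id2 A f) = f"
    and cod2_id2: "f \<in> Mor A \<Longrightarrow> cod2 A (id2 A f) = f"
    and vcomp_Cell: "\<lbrakk>b \<in> Cell A; a \<in> Cell A; dom2 A b = cod2 A a\<rbrakk> \<Longrightarrow> b \<bullet> a \<in> Cell A"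
    and dom2_vcomp: "\<lbrakk>b \<in> Cell A; a \<in> Cell A; dom2 A b = cod2 A a\<rbrakk> \<Longrightarrow> dom2 A (b \<bullet> a) = dom2 A a"
    and cod2_vcomp: "\<lbrakk>b \<in> Cell A; a \<in> Cell A; dom2 A b = cod2 A a\<rbrakk> \<Longrightarrow> cod2 A (b \<bullet> a) = cod2 A b"
    and vcomp_id2_left: "a \<in> Cell A \<Longrightarrow> id2 A (cod2 A a) \<bullet> a = a"
    and vcomp_id2_right: "a \<in> Cell A \<Longrightarrow> a \<bullet> id2 A (dom2 A a) = a"
    and vcomp_assoc: "\<lbrakk>c \<in> Cell A; b \<in> Cell A; a \<in> Cell A; dom2 A c = cod2 A b; dom2 A b = cod2 A a\<rbrakk>
          \<Longrightarrow> c \<bullet> b \<bullet> a = c \<bullet> (b \<bullet> a)"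
    and hcomp_Cell: "\<lbrakk>b \<in> Cell A; a \<in> Cell A; dom1 A (dom2 A b) = cod1 A (dom2 A a)\<rbrakk>
          \<Longrightarrow> b \<star> a \<in> Cell A"
    and dom2_hcomp: "\<lbrakk>b \<in> Cell A; a \<in> Cell A; dom1 A (dom2 A b) = cod1 A (dom2 A a)\<rbrakk>
          \<Longrightarrow> dom2 A (b \<star> a) = dom2 A b \<cdot> dom2 A a"
    and cod2_hcomp: "\<lbrakk>b \<in> Cell A; a \<in> Cell A; dom1 A (dom2 A b) = cod1 A (dom2 A a)\<rbrakk>
          \<Longrightarrow> cod2 A (b \<star> a) = cod2 A b \<cdot> cod2 A a"
    and hcomp_id_left: "a \<in> Cell A \<Longrightarrow> id2 A (id1 A (cod1 A (dom2 A a))) \<star> a = a"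
    and hcomp_id_right: "a \<in> Cell A \<Longrightarrow> a \<star> id2 A (id1 A (dom1 A (dom2 A a))) = a"
    and hcomp_assoc: "\<lbrakk>c \<in> Cell A; b \<in> Cell A; a \<in> Cell A;
            dom1 A (dom2 A c) = cod1 A (dom2 A b); dom1 A (dom2 A b) = cod1 A (dom2 A a)\<rbrakk>
          \<Longrightarrow> c \<star> b \<star> a = c \<star> (b \<star> a)"
    and hcomp_id2: "\<lbrakk>g \<in> Mor A; f \<in> Mor A; dom1 A g = cod1 A f\<rbrakk>
          \<Longrightarrow> id2 A g \<star> id2 A f = id2 A (g \<cdot> f)"
    and interchange: "\<lbrakk>b' \<in> Cell A; b \<in> Cell A; a' \<in> Cell A; a \<in> Cell A;
            dom2 A b' = cod2 A b; dom2 A a' = cod2 A a; dom1 A (dom2 A b) = cod1 A (dom2 A a)\<rbrakk>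
          \<Longrightarrow> (b' \<bullet> b) \<star> (a' \<bullet> a) = (b' \<star> a') \<bullet> (b \<star> a)"

definition hom1 :: "('o, 'm, 't) two_cat \<Rightarrow> 'o \<Rightarrow> 'o \<Rightarrow> 'm set" where
  "hom1 A x y = {f \<in> Mor A. dom1 A f = x \<and> cod1 A f = y}"

definition hom2 :: "('o, 'm, 't) two_cat \<Rightarrow> 'm \<Rightarrow> 'm \<Rightarrow> 't set" where
  "hom2 A f g = {a \<in> Cell A. dom2 A a = f \<and> cod2 A a = g}"

definition invertible2 :: "('o, 'm, 't) two_cat \<Rightarrow> 't \<Rightarrow> bool" where
  "invertible2 A a \<longleftrightarrow> a \<in> Cell A \<and>
     (\<exists>b \<in> hom2 A (cod2 A a) (dom2 A a).
        b \<bullet>\<^bsub>A\<^esub> a = id2 A (dom2 A a) \<and> a \<bullet>\<^bsub>A\<^esub> b = id2 A (cod2 A a))"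

definition hom_cat :: "('o, 'm, 't) two_cat \<Rightarrow> 'o \<Rightarrow> 'o \<Rightarrow> ('m, 't) cat" where
  "hom_cat A x y = \<lparr>Ob = hom1 A x y,
     Ar = {a \<in> Cell A. dom2 A a \<in> hom1 A x y \<and> cod2 A a \<in> hom1 A x y},
     dm = dom2 A, cd = cod2 A, ident = id2 A, cmp = vcomp A\<rparr>"

definition two_terminal :: "('o, 'm, 't) two_cat \<Rightarrow> 'o \<Rightarrow> bool" where
  "two_terminal B L \<longleftrightarrow> L \<in> Obj B \<and> (\<forall>X \<in> Obj B. isomorphic_cats (hom_cat B X L) terminal_cat)"

text \<open>A category regarded as a 2-category with only identity 2-morphisms; the identity
  2-morphism of \<open>f\<close> is represented by \<open>f\<close> itself.\<close>

definition locally_discrete :: "('o, 'm) cat \<Rightarrow> ('o, 'm, 'm) two_cat" where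
  "locally_discrete C = \<lparr>Obj = Ob C, Mor = Ar C, Cell = Ar C,
     dom1 = dm C, cod1 = cd C, dom2 = (\<lambda>f. f), cod2 = (\<lambda>f. f),
     id1 = ident C, comp1 = cmp C, id2 = (\<lambda>f. f), vcomp = (\<lambda>g f. f), hcomp = cmp C\<rparr>"

text \<open>The category \<open>{0 \<rightarrow> 1}\<close>: the unique arrow from \<open>i\<close> to \<open>j\<close> is the pair \<open>(i, j)\<close>.\<close>

definition arrow_cat :: "(nat, nat \<times> nat) cat" where
  "arrow_cat = \<lparr>Ob = {0, 1}, Ar = {(0, 0), (0, 1), (1, 1)}, dm = fst, cd = snd,
     ident = (\<lambda>i. (i, i)), cmp = (\<lambda>g f. (fst f, snd g))\<rparr>"

definition two :: "(nat, nat \<times> nat, nat \<times> nat) two_cat" where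
  "two = locally_discrete arrow_cat"

section \<open>2-functors, lax-natural transformations, modifications\<close>

text \<open>All these carry their (co)domain where needed, and their underlying functions are
  \<^emph>\<open>extensional\<close> (equal to \<open>undefined\<close> outside the relevant carrier), so that HOL equality
  is equality of 2-functors, transformations and modifications.\<close>

record ('i, 'j, 'k, 'o, 'm, 't) two_fun =
  fob :: "'i \<Rightarrow> 'o"
  fmor :: "'j \<Rightarrow> 'm"
  fcell :: "'k \<Rightarrow> 't"

definition two_functor ::
  "('i, 'j, 'k) two_cat \<Rightarrow> ('o, 'm, 't) two_cat \<Rightarrow> ('i, 'j, 'k, 'o, 'm, 't) two_fun \<Rightarrow> bool" where
  "two_functor I A F \<longleftrightarrow>
     fob F \<in> extensional (Obj I) \<and> fmor F \<in> extensional (Mor I) \<and> fcell F \<in> extensional (Cell I) \<and>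
     (\<forall>i \<in> Obj I. fob F i \<in> Obj A) \<and>
     (\<forall>f \<in> Mor I. fmor F f \<in> hom1 A (fob F (dom1 I f)) (fob F (cod1 I f))) \<and>
     (\<forall>a \<in> Cell I. fcell F a \<in> hom2 A (fmor F (dom2 I a)) (fmor F (cod2 I a))) \<and>
     (\<forall>i \<in> Obj I. fmor F (id1 I i) = id1 A (fob F i)) \<and>
     (\<forall>g \<in> Mor I. \<forall>f \<in> Mor I. dom1 I g = cod1 I f \<longrightarrow>
        fmor F (g \<cdot>\<^bsub>I\<^esub> f) = fmor F g \<cdot>\<^bsub>A\<^esub> fmor F f) \<and>
     (\<forall>f \<in> Mor I. fcell F (id2 I f) = id2 A (fmor F f)) \<and>
     (\<forall>b \<in> Cell I. \<forall>a \<in> Cell I. dom2 I b = cod2 I a \<longrightarrow>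
        fcell F (b \<bullet>\<^bsub>I\<^esub> a) = fcell F b \<bullet>\<^bsub>A\<^esub> fcell F a) \<and>
     (\<forall>b \<in> Cell I. \<forall>a \<in> Cell I. dom1 I (dom2 I b) = cod1 I (dom2 I a) \<longrightarrow>
        fcell F (b \<star>\<^bsub>I\<^esub> a) = fcell F b \<star>\<^bsub>A\<^esub> fcell F a)"

record ('i, 'j, 'k, 'o, 'm, 't) lax =
  ldom :: "('i, 'j, 'k, 'o, 'm, 't) two_fun"
  lcod :: "('i, 'j, 'k, 'o, 'm, 't) two_fun"
  lob :: "'i \<Rightarrow> 'm"
  lmor :: "'j \<Rightarrow> 't"

definition lax_natural ::
  "('i, 'j, 'k) two_cat \<Rightarrow> ('o, 'm, 't) two_cat \<Rightarrow> ('i, 'j, 'k, 'o, 'm, 't) lax \<Rightarrow> bool" where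
  "lax_natural I A \<mu> \<longleftrightarrow> (let F = ldom \<mu>; G = lcod \<mu> in
     two_functor I A F \<and> two_functor I A G \<and>
     lob \<mu> \<in> extensional (Obj I) \<and> lmor \<mu> \<in> extensional (Mor I) \<and>
     (\<forall>i \<in> Obj I. lob \<mu> i \<in> hom1 A (fob F i) (fob G i)) \<and>
     (\<forall>f \<in> Mor I. lmor \<mu> f \<in> hom2 A (fmor G f \<cdot>\<^bsub>A\<^esub> lob \<mu> (dom1 I f)) (lob \<mu> (cod1 I f) \<cdot>\<^bsub>A\<^esub> fmor F f)) \<and>
     (\<forall>i \<in> Obj I. lmor \<mu> (id1 I i) = id2 A (lob \<mu> i)) \<and>
     (\<forall>g \<in> Mor I. \<forall>f \<in> Mor I. dom1 I g = cod1 I f \<longrightarrow>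
        lmor \<mu> (g \<cdot>\<^bsub>I\<^esub> f) =
          (lmor \<mu> g \<star>\<^bsub>A\<^esub> id2 A (fmor F f)) \<bullet>\<^bsub>A\<^esub> (id2 A (fmor G g) \<star>\<^bsub>A\<^esub> lmor \<mu> f)) \<and>
     (\<forall>a \<in> Cell I.
        lmor \<mu> (cod2 I a) \<bullet>\<^bsub>A\<^esub> (fcell G a \<star>\<^bsub>A\<^esub> id2 A (lob \<mu> (dom1 I (dom2 I a)))) =
        (id2 A (lob \<mu> (cod1 I (dom2 I a))) \<star>\<^bsub>A\<^esub> fcell F a) \<bullet>\<^bsub>A\<^esub> lmor \<mu> (dom2 I a)))"

definition pseudo_natural ::
  "('i, 'j, 'k) two_cat \<Rightarrow> ('o, 'm, 't) two_cat \<Rightarrow> ('i, 'j, 'k, 'o, 'm, 't) lax \<Rightarrow> bool" where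
  "pseudo_natural I A \<mu> \<longleftrightarrow> lax_natural I A \<mu> \<and> (\<forall>f \<in> Mor I. invertible2 A (lmor \<mu> f))"

record ('i, 'j, 'k, 'o, 'm, 't) modif =
  mdom :: "('i, 'j, 'k, 'o, 'm, 't) lax"
  mcod :: "('i, 'j, 'k, 'o, 'm, 't) lax"
  mob :: "'i \<Rightarrow> 't"

definition modification ::
  "('i, 'j, 'k) two_cat \<Rightarrow> ('o, 'm, 't) two_cat \<Rightarrow> ('i, 'j, 'k, 'o, 'm, 't) modif \<Rightarrow> bool" where
  "modification I A \<phi> \<longleftrightarrow> (let \<mu> = mdom \<phi>; \<nu> = mcod \<phi>; F = ldom \<mu>; G = lcod \<mu> in
     lax_natural I A \<mu> \<and> lax_natural I A \<nu> \<and> ldom \<nu> = F \<and> lcod \<nu> = G \<and>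
     mob \<phi> \<in> extensional (Obj I) \<and>
     (\<forall>i \<in> Obj I. mob \<phi> i \<in> hom2 A (lob \<mu> i) (lob \<nu> i)) \<and>
     (\<forall>f \<in> Mor I.
        lmor \<nu> f \<bullet>\<^bsub>A\<^esub> (id2 A (fmor G f) \<star>\<^bsub>A\<^esub> mob \<phi> (dom1 I f)) =
        (mob \<phi> (cod1 I f) \<star>\<^bsub>A\<^esub> id2 A (fmor F f)) \<bullet>\<^bsub>A\<^esub> lmor \<mu> f))"

text \<open>The 2-categories \<open>Lax[I, A]\<close> and \<open>Ps[I, A]\<close>.  The component at \<open>f : i \<rightarrow> j\<close> of a composite
  \<open>\<nu>\<mu>\<close> of \<open>\<mu> : F \<Rightarrow> G\<close> and \<open>\<nu> : G \<Rightarrow> H\<close> is the pasting \<open>(\<nu>\<^sub>j * \<mu>\<^sub>f)(\<nu>\<^sub>f * \<mu>\<^sub>i)\<close>.\<close>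

definition lax_comp ::
  "('i, 'j, 'k) two_cat \<Rightarrow> ('o, 'm, 't) two_cat \<Rightarrow> ('i, 'j, 'k, 'o, 'm, 't) lax \<Rightarrow>
   ('i, 'j, 'k, 'o, 'm, 't) lax \<Rightarrow> ('i, 'j, 'k, 'o, 'm, 't) lax" where
  "lax_comp I A \<nu> \<mu> = \<lparr>ldom = ldom \<mu>, lcod = lcod \<nu>,
     lob = (\<lambda>i \<in> Obj I. lob \<nu> i \<cdot>\<^bsub>A\<^esub> lob \<mu> i),
     lmor = (\<lambda>f \<in> Mor I. (id2 A (lob \<nu> (cod1 I f)) \<star>\<^bsub>A\<^esub> lmor \<mu> f) \<bullet>\<^bsub>A\<^esub>
                           (lmor \<nu> f \<star>\<^bsub>A\<^esub> id2 A (lob \<mu> (dom1 I f))))\<rparr>"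

definition Lax :: "('i, 'j, 'k) two_cat \<Rightarrow> ('o, 'm, 't) two_cat \<Rightarrow>
    (('i, 'j, 'k, 'o, 'm, 't) two_fun, ('i, 'j, 'k, 'o, 'm, 't) lax, ('i, 'j, 'k, 'o, 'm, 't) modif) two_cat"
  where
  "Lax I A = \<lparr>
     Obj = Collect (two_functor I A),
     Mor = Collect (lax_natural I A),
     Cell = Collect (modification I A),
     dom1 = ldom, cod1 = lcod, dom2 = mdom, cod2 = mcod,
     id1 = (\<lambda>F. \<lparr>ldom = F, lcod = F, lob = (\<lambda>i \<in> Obj I. id1 A (fob F i)),
        lmor = (\<lambda>f \<in> Mor I. id2 A (fmor F f))\<rparr>),
     comp1 = lax_comp I A,
     id2 = (\<lambda>\<mu>. \<lparr>mdom = \<mu>, mcod = \<mu>, mob = (\<lambda>i \<in> Obj I. id2 A (lob \<mu> i))\<rparr>),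
     vcomp = (\<lambda>\<psi> \<phi>. \<lparr>mdom = mdom \<phi>, mcod = mcod \<psi>,
        mob = (\<lambda>i \<in> Obj I. mob \<psi> i \<bullet>\<^bsub>A\<^esub> mob \<phi> i)\<rparr>),
     hcomp = (\<lambda>\<psi> \<phi>. \<lparr>mdom = lax_comp I A (mdom \<psi>) (mdom \<phi>),
        mcod = lax_comp I A (mcod \<psi>) (mcod \<phi>),
        mob = (\<lambda>i \<in> Obj I. mob \<psi> i \<star>\<^bsub>A\<^esub> mob \<phi> i)\<rparr>)\<rparr>"

definition Ps :: "('i, 'j, 'k) two_cat \<Rightarrow> ('o, 'm, 't) two_cat \<Rightarrow>
    (('i, 'j, 'k, 'o, 'm, 't) two_fun, ('i, 'j, 'k, 'o, 'm, 't) lax, ('i, 'j, 'k, 'o, 'm, 't) modif) two_cat"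
  where
  "Ps I A = (Lax I A)\<lparr>
     Mor := Collect (pseudo_natural I A),
     Cell := {\<phi>. modification I A \<phi> \<and> pseudo_natural I A (mdom \<phi>) \<and> pseudo_natural I A (mcod \<phi>)}\<rparr>"

text \<open>The diagonal \<open>\<Delta>\<close> on objects, morphisms and 2-morphisms.\<close>

definition Delta0 :: "('i, 'j, 'k) two_cat \<Rightarrow> ('o, 'm, 't) two_cat \<Rightarrow> 'o \<Rightarrow>
    ('i, 'j, 'k, 'o, 'm, 't) two_fun" where
  "Delta0 I A X = \<lparr>fob = (\<lambda>_ \<in> Obj I. X), fmor = (\<lambda>_ \<in> Mor I. id1 A X),
     fcell = (\<lambda>_ \<in> Cell I. id2 A (id1 A X))\<rparr>"

definition Delta1 :: "('i, 'j, 'k) two_cat \<Rightarrow> ('o, 'm, 't) two_cat \<Rightarrow> 'm \<Rightarrow>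
    ('i, 'j, 'k, 'o, 'm, 't) lax" where
  "Delta1 I A h = \<lparr>ldom = Delta0 I A (dom1 A h), lcod = Delta0 I A (cod1 A h),
     lob = (\<lambda>_ \<in> Obj I. h), lmor = (\<lambda>_ \<in> Mor I. id2 A h)\<rparr>"

definition Delta2 :: "('i, 'j, 'k) two_cat \<Rightarrow> ('o, 'm, 't) two_cat \<Rightarrow> 't \<Rightarrow>
    ('i, 'j, 'k, 'o, 'm, 't) modif" where
  "Delta2 I A \<beta> = \<lparr>mdom = Delta1 I A (dom2 A \<beta>), mcod = Delta1 I A (cod2 A \<beta>),
     mob = (\<lambda>_ \<in> Obj I. \<beta>)\<rparr>"

section \<open>Limits and pseudo-slices\<close>

text \<open>The notions for lax-cones and for pseudo-cones differ only in the 2-category \<open>T\<close> of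
  transformations used, \<open>Lax I A\<close> or \<open>Ps I A\<close>; both are therefore defined once with \<open>T\<close>
  as a parameter.\<close>

definition cones_over where
  "cones_over I A T F X = hom1 T (Delta0 I A X) F"

text \<open>The action on objects and on morphisms of the functor
  \<open>\<lambda>\<^sub>* \<circ> \<Delta> : A(X, L) \<rightarrow> T(\<Delta>X, F)\<close>.\<close>

definition postcomp_ob where
  "postcomp_ob I A T l h = l \<cdot>\<^bsub>T\<^esub> Delta1 I A h"

definition postcomp_ar where
  "postcomp_ar I A T l \<beta> = id2 T l \<star>\<^bsub>T\<^esub> Delta2 I A \<beta>"

definition limit_wrt where
  "limit_wrt I A T F L l \<longleftrightarrow> L \<in> Obj A \<and> l \<in> cones_over I A T F L \<and>
     (\<forall>X \<in> Obj A. is_cat_iso (hom_cat A X L) (hom_cat T (Delta0 I A X) F)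
        (postcomp_ob I A T l) (postcomp_ar I A T l))"

definition lax_limit :: "('i, 'j, 'k) two_cat \<Rightarrow> ('o, 'm, 't) two_cat \<Rightarrow> ('i, 'j, 'k, 'o, 'm, 't) two_fun \<Rightarrow>
    'o \<Rightarrow> ('i, 'j, 'k, 'o, 'm, 't) lax \<Rightarrow> bool" where
  "lax_limit I A F L l \<longleftrightarrow> limit_wrt I A (Lax I A) F L l"

definition pseudo_limit :: "('i, 'j, 'k) two_cat \<Rightarrow> ('o, 'm, 't) two_cat \<Rightarrow> ('i, 'j, 'k, 'o, 'm, 't) two_fun \<Rightarrow>
    'o \<Rightarrow> ('i, 'j, 'k, 'o, 'm, 't) lax \<Rightarrow> bool" where
  "pseudo_limit I A F L l \<longleftrightarrow> limit_wrt I A (Ps I A) F L l"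

text \<open>A morphism of the pseudo-slice is recorded with its domain and codomain, and so is a
  2-morphism, since these are not determined by \<open>(h, \<phi>)\<close> and \<open>\<beta>\<close>.\<close>

record ('p, 'h, 'f) slice_mor =
  sdom :: 'p
  scod :: 'p
  smor :: 'h
  smod :: 'f

record ('n, 't) slice_cell =
  cdom :: 'n
  ccod :: 'n
  ccell :: 't

definition slice_obj where
  "slice_obj I A T F = {(X, \<mu>). X \<in> Obj A \<and> \<mu> \<in> cones_over I A T F X}"

definition slice_hom where
  "slice_hom I A T F = {m. sdom m \<in> slice_obj I A T F \<and> scod m \<in> slice_obj I A T F \<and>
     smor m \<in> hom1 A (fst (sdom m)) (fst (scod m)) \<and>
     smod m \<in> hom2 T (snd (scod m) \<cdot>\<^bsub>T\<^esub> Delta1 I A (smor m)) (snd (sdom m)) \<and>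
     invertible2 T (smod m)}"

definition slice_two_hom where
  "slice_two_hom I A T F = {b. cdom b \<in> slice_hom I A T F \<and> ccod b \<in> slice_hom I A T F \<and>
     sdom (cdom b) = sdom (ccod b) \<and> scod (cdom b) = scod (ccod b) \<and>
     ccell b \<in> hom2 A (smor (cdom b)) (smor (ccod b)) \<and>
     smod (ccod b) \<bullet>\<^bsub>T\<^esub> (id2 T (snd (scod (cdom b))) \<star>\<^bsub>T\<^esub> Delta2 I A (ccell b)) = smod (cdom b)}"

text \<open>The composite of \<open>(h, \<phi>) : (X, \<mu>) \<rightarrow> (Y, \<nu>)\<close> and \<open>(k, \<psi>) : (Y, \<nu>) \<rightarrow> (Z, \<rho>)\<close> is
  \<open>(kh, \<phi>(\<psi> * \<Delta>h))\<close>; 2-morphisms compose as in \<open>A\<close>.\<close>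

definition slice_comp where
  "slice_comp I A T n m = \<lparr>sdom = sdom m, scod = scod n, smor = smor n \<cdot>\<^bsub>A\<^esub> smor m,
     smod = smod m \<bullet>\<^bsub>T\<^esub> (smod n \<star>\<^bsub>T\<^esub> id2 T (Delta1 I A (smor m)))\<rparr>"

definition pseudo_slice where
  "pseudo_slice I A T F = \<lparr>
     Obj = slice_obj I A T F, Mor = slice_hom I A T F, Cell = slice_two_hom I A T F,
     dom1 = sdom, cod1 = scod, dom2 = cdom, cod2 = ccod,
     id1 = (\<lambda>p. \<lparr>sdom = p, scod = p, smor = id1 A (fst p), smod = id2 T (snd p)\<rparr>),
     comp1 = slice_comp I A T,
     id2 = (\<lambda>m. \<lparr>cdom = m, ccod = m, ccell = id2 A (smor m)\<rparr>),
     vcomp = (\<lambda>c b. \<lparr>cdom = cdom b, ccod = ccod c, ccell = ccell c \<bullet>\<^bsub>A\<^esub> ccell b\<rparr>),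
     hcomp = (\<lambda>c b. \<lparr>cdom = slice_comp I A T (cdom c) (cdom b),
        ccod = slice_comp I A T (ccod c) (ccod b), ccell = ccell c \<star>\<^bsub>A\<^esub> ccell b\<rparr>)\<rparr>"

definition pseudo_slice_lax_cones where
  "pseudo_slice_lax_cones I A F = pseudo_slice I A (Lax I A) F"

definition pseudo_slice_pseudo_cones where
  "pseudo_slice_pseudo_cones I A F = pseudo_slice I A (Ps I A) F"

section \<open>The 2-category generated by given data\<close>

text \<open>A path is \<open>(x, es, y)\<close>, where \<open>es\<close> lists composable generating morphisms from \<open>x\<close> to \<open>y\<close>
  in the order of composition, the last one being applied first.\<close>

type_synonym ('x, 'e) path = "'x \<times> 'e list \<times> 'x"

record ('x, 'e, 'c) generators =
  gobj :: "'x set"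
  gmor :: "'e set"
  gdom :: "'e \<Rightarrow> 'x"
  gcod :: "'e \<Rightarrow> 'x"
  gcell :: "'c set"
  gdom2 :: "'c \<Rightarrow> ('x, 'e) path"
  gcod2 :: "'c \<Rightarrow> ('x, 'e) path"
  ginv :: "'c set"  \<comment> \<open>the generating 2-morphisms declared invertible\<close>

inductive_set paths :: "('x, 'e, 'c) generators \<Rightarrow> ('x, 'e) path set" for P where
  Nil: "x \<in> gobj P \<Longrightarrow> (x, [], x) \<in> paths P"
| Cons: "\<lbrakk>(x, es, gdom P e) \<in> paths P; e \<in> gmor P\<rbrakk> \<Longrightarrow> (x, e # es, gcod P e) \<in> paths P"

definition pdom :: "('x, 'e) path \<Rightarrow> 'x" where "pdom p = fst p"
definition pcod :: "('x, 'e) path \<Rightarrow> 'x" where "pcod p = snd (snd p)"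

definition pcomp :: "('x, 'e) path \<Rightarrow> ('x, 'e) path \<Rightarrow> ('x, 'e) path" where
  "pcomp q p = (pdom p, fst (snd q) @ fst (snd p), pcod q)"

definition well_formed :: "('x, 'e, 'c) generators \<Rightarrow> bool" where
  "well_formed P \<longleftrightarrow>
     (\<forall>e \<in> gmor P. gdom P e \<in> gobj P \<and> gcod P e \<in> gobj P) \<and>
     (\<forall>c \<in> gcell P. gdom2 P c \<in> paths P \<and> gcod2 P c \<in> paths P \<and>
        pdom (gdom2 P c) = pdom (gcod2 P c) \<and> pcod (gdom2 P c) = pcod (gcod2 P c)) \<and>
     ginv P \<subseteq> gcell P"

datatype ('x, 'e, 'c) cterm =
    Gen 'c
  | Inv 'c
  | Idt "('x, 'e) path"
  | VC "('x, 'e, 'c) cterm" "('x, 'e, 'c) cterm"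
  | HC "('x, 'e, 'c) cterm" "('x, 'e, 'c) cterm"

primrec tdom :: "('x, 'e, 'c) generators \<Rightarrow> ('x, 'e, 'c) cterm \<Rightarrow> ('x, 'e) path" where
  "tdom P (Gen c) = gdom2 P c"
| "tdom P (Inv c) = gcod2 P c"
| "tdom P (Idt p) = p"
| "tdom P (VC t u) = tdom P u"
| "tdom P (HC t u) = pcomp (tdom P t) (tdom P u)"

primrec tcod :: "('x, 'e, 'c) generators \<Rightarrow> ('x, 'e, 'c) cterm \<Rightarrow> ('x, 'e) path" where
  "tcod P (Gen c) = gcod2 P c"
| "tcod P (Inv c) = gdom2 P c"
| "tcod P (Idt p) = p"
| "tcod P (VC t u) = tcod P t"
| "tcod P (HC t u) = pcomp (tcod P t) (tcod P u)"

inductive_set cterms :: "('x, 'e, 'c) generators \<Rightarrow> ('x, 'e, 'c) cterm set" for P where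
  Gen: "c \<in> gcell P \<Longrightarrow> Gen c \<in> cterms P"
| Inv: "c \<in> ginv P \<Longrightarrow> Inv c \<in> cterms P"
| Idt: "p \<in> paths P \<Longrightarrow> Idt p \<in> cterms P"
| V: "\<lbrakk>t \<in> cterms P; u \<in> cterms P; tdom P t = tcod P u\<rbrakk> \<Longrightarrow> VC t u \<in> cterms P"
| H: "\<lbrakk>t \<in> cterms P; u \<in> cterms P; pdom (tdom P t) = pcod (tdom P u)\<rbrakk> \<Longrightarrow> HC t u \<in> cterms P"

text \<open>The least congruence on well-formed terms containing the 2-category axioms and the
  equations making \<open>Inv c\<close> inverse to \<open>Gen c\<close>.\<close>

inductive cong :: "('x, 'e, 'c) generators \<Rightarrow> ('x, 'e, 'c) cterm \<Rightarrow> ('x, 'e, 'c) cterm \<Rightarrow> bool"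
  for P where
  refl: "t \<in> cterms P \<Longrightarrow> cong P t t"
| sym: "cong P t u \<Longrightarrow> cong P u t"
| trans: "\<lbrakk>cong P t u; cong P u v\<rbrakk> \<Longrightarrow> cong P t v"
| V: "\<lbrakk>cong P t t'; cong P u u'; VC t u \<in> cterms P\<rbrakk> \<Longrightarrow> cong P (VC t u) (VC t' u')"
| H: "\<lbrakk>cong P t t'; cong P u u'; HC t u \<in> cterms P\<rbrakk> \<Longrightarrow> cong P (HC t u) (HC t' u')"
| V_assoc: "VC (VC t u) v \<in> cterms P \<Longrightarrow> cong P (VC (VC t u) v) (VC t (VC u v))"
| V_id_left: "t \<in> cterms P \<Longrightarrow> cong P (VC (Idt (tcod P t)) t) t"
| V_id_right: "t \<in> cterms P \<Longrightarrow> cong P (VC t (Idt (tdom P t))) t"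
| H_assoc: "HC (HC t u) v \<in> cterms P \<Longrightarrow> cong P (HC (HC t u) v) (HC t (HC u v))"
| H_id_left: "t \<in> cterms P \<Longrightarrow>
    cong P (HC (Idt (pcod (tdom P t), [], pcod (tdom P t))) t) t"
| H_id_right: "t \<in> cterms P \<Longrightarrow>
    cong P (HC t (Idt (pdom (tdom P t), [], pdom (tdom P t)))) t"
| H_id: "HC (Idt q) (Idt p) \<in> cterms P \<Longrightarrow> cong P (HC (Idt q) (Idt p)) (Idt (pcomp q p))"
| interchange: "HC (VC t' t) (VC u' u) \<in> cterms P \<Longrightarrow>
    cong P (HC (VC t' t) (VC u' u)) (VC (HC t' u') (HC t u))"
| Inv_left: "c \<in> ginv P \<Longrightarrow> cong P (VC (Inv c) (Gen c)) (Idt (gdom2 P c))"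
| Inv_right: "c \<in> ginv P \<Longrightarrow> cong P (VC (Gen c) (Inv c)) (Idt (gcod2 P c))"

definition cls :: "('x, 'e, 'c) generators \<Rightarrow> ('x, 'e, 'c) cterm \<Rightarrow> ('x, 'e, 'c) cterm set" where
  "cls P t = {u. cong P t u}"

definition free_two_cat ::
  "('x, 'e, 'c) generators \<Rightarrow> ('x, ('x, 'e) path, ('x, 'e, 'c) cterm set) two_cat" where
  "free_two_cat P = \<lparr>
     Obj = gobj P, Mor = paths P, Cell = cls P ` cterms P,
     dom1 = pdom, cod1 = pcod,
     dom2 = (\<lambda>a. the_elem (tdom P ` a)), cod2 = (\<lambda>a. the_elem (tcod P ` a)),
     id1 = (\<lambda>x. (x, [], x)), comp1 = pcomp,
     id2 = (\<lambda>p. cls P (Idt p)),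
     vcomp = (\<lambda>b a. \<Union>t \<in> b. \<Union>u \<in> a. cls P (VC t u)),
     hcomp = (\<lambda>b a. \<Union>t \<in> b. \<Union>u \<in> a. cls P (HC t u))\<rparr>"

section \<open>The 2-functor given by a morphism, and its cone\<close>

text \<open>The 2-functor out of \<open>two\<close> given by a morphism \<open>m : a \<rightarrow> b\<close>.\<close>

definition arrow_fmor :: "('o, 'm, 't) two_cat \<Rightarrow> 'm \<Rightarrow> nat \<times> nat \<Rightarrow> 'm" where
  "arrow_fmor A m e =
     (if e = (0, 0) then id1 A (dom1 A m) else if e = (1, 1) then id1 A (cod1 A m) else m)"

definition arrow_functor ::
  "('o, 'm, 't) two_cat \<Rightarrow> 'm \<Rightarrow> (nat, nat \<times> nat, nat \<times> nat, 'o, 'm, 't) two_fun" where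
  "arrow_functor A m = \<lparr>
     fob = (\<lambda>i \<in> Obj two. if i = 0 then dom1 A m else cod1 A m),
     fmor = (\<lambda>e \<in> Mor two. arrow_fmor A m e),
     fcell = (\<lambda>e \<in> Cell two. id2 A (arrow_fmor A m e))\<rparr>"

text \<open>The cone on \<open>m\<close> with components \<open>id\<^sub>a\<close> and \<open>m\<close> and with identity 2-morphism components;
  those at the identities of \<open>two\<close> are forced by the axioms.\<close>

definition id_cone ::
  "('o, 'm, 't) two_cat \<Rightarrow> 'm \<Rightarrow> (nat, nat \<times> nat, nat \<times> nat, 'o, 'm, 't) lax" where
  "id_cone A m = \<lparr>
     ldom = Delta0 two A (dom1 A m),
     lcod = arrow_functor A m,
     lob = (\<lambda>i \<in> Obj two. if i = 0 then id1 A (dom1 A m) else m),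
     lmor = (\<lambda>e \<in> Mor two. if e = (0, 0) then id2 A (id1 A (dom1 A m)) else id2 A m)\<rparr>"

section \<open>The example\<close>

datatype ex_obj = obX | obA | obB
datatype ex_mor = mor_alpha0 | mor_alpha1 | mor_f
datatype ex_cell = cell_alpha

primrec ex_dom :: "ex_mor \<Rightarrow> ex_obj" where
  "ex_dom mor_alpha0 = obX" | "ex_dom mor_alpha1 = obX" | "ex_dom mor_f = obA"

primrec ex_cod :: "ex_mor \<Rightarrow> ex_obj" where
  "ex_cod mor_alpha0 = obA" | "ex_cod mor_alpha1 = obB" | "ex_cod mor_f = obB"

definition ex_generators :: "(ex_obj, ex_mor, ex_cell) generators" where
  "ex_generators = \<lparr>gobj = UNIV, gmor = UNIV, gdom = ex_dom, gcod = ex_cod,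
     gcell = UNIV,
     gdom2 = (\<lambda>_. (obX, [mor_f, mor_alpha0], obB)),
     gcod2 = (\<lambda>_. (obX, [mor_alpha1], obB)),
     ginv = UNIV\<rparr>"

definition exA ::
  "(ex_obj, (ex_obj, ex_mor) path, (ex_obj, ex_mor, ex_cell) cterm set) two_cat" where
  "exA = free_two_cat ex_generators"

definition exf :: "(ex_obj, ex_mor) path" where
  "exf = (obA, [mor_f], obB)"

section \<open>Sanity facts\<close>

text \<open>The generated structure is a 2-category, and the data of the example are what they should be:
  a 2-functor and a pseudo-cone (hence lax-cone) over it.\<close>

lemma path_ends:
  assumes "p \<in> paths P" "well_formed P"
  shows "pdom p \<in> gobj P \<and> pcod p \<in> gobj P"
proof -
  have "x \<in> gobj P \<and> y \<in> gobj P" if "(x, es, y) \<in> paths P" for x es y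
    using that assms(2) by (induction rule: paths.induct) (auto simp: well_formed_def)
  then show ?thesis using assms(1) by (cases p) (auto simp: pdom_def pcod_def)
qed

lemma pcomp_paths:
  assumes "q \<in> paths P" "p \<in> paths P" "pdom q = pcod p"
  shows "pcomp q p \<in> paths P"
proof -
  have "(pdom p, es @ fst (snd p), z) \<in> paths P" if "(y, es, z) \<in> paths P" "y = pcod p" for y es z
    using that
  proof (induction rule: paths.induct)
    case (Nil x)
    then show ?case using assms(2) by (simp add: pdom_def pcod_def)
  qed (auto intro: paths.Cons)
  then show ?thesis using assms(1,3) by (cases q) (auto simp: pcomp_def pdom_def pcod_def)
qed

lemma pdom_pcomp [simp]: "pdom (pcomp q p) = pdom p"
  and pcod_pcomp [simp]: "pcod (pcomp q p) = pcod q"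
  by (simp_all add: pcomp_def pdom_def pcod_def)

lemma pcomp_assoc: "pcomp (pcomp r q) p = pcomp r (pcomp q p)"
  by (simp add: pcomp_def pdom_def pcod_def)

lemma pcomp_id [simp]: "pcod p = y \<Longrightarrow> pcomp (y, [], y) p = p" "pdom p = x \<Longrightarrow> pcomp p (x, [], x) = p"
  by (auto simp add: pcomp_def pdom_def pcod_def)

lemma pd_triple [simp]: "pdom (x, es, y) = x" "pcod (x, es, y) = y"
  by (simp_all add: pdom_def pcod_def)

lemma cterm_ends:
  assumes "well_formed P" "t \<in> cterms P"
  shows "tdom P t \<in> paths P \<and> tcod P t \<in> paths P \<and>
         pdom (tcod P t) = pdom (tdom P t) \<and> pcod (tcod P t) = pcod (tdom P t)"
  using assms(2)
  by induction (use assms(1) in \<open>auto simp: well_formed_def intro: pcomp_paths\<close>)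

inductive_cases VC_E: "VC t u \<in> cterms P"
inductive_cases Idt_E: "Idt p \<in> cterms P"
inductive_cases HC_E: "HC t u \<in> cterms P"

lemma cong_cterms:
  assumes wf: "well_formed P" and "cong P t u"
  shows "t \<in> cterms P \<and> u \<in> cterms P \<and> tdom P t = tdom P u \<and> tcod P t = tcod P u"
  using assms(2)
proof induction
  case (Inv_left c)
  then show ?case using wf by (force simp: well_formed_def intro: cterms.intros)
next
  case (Inv_right c)
  then show ?case using wf by (force simp: well_formed_def intro: cterms.intros)
next
  case (V_id_left t)
  then show ?case using cterm_ends[OF wf V_id_left] by (simp add: cterms.V cterms.Idt)
next
  case (V_id_right t)
  then show ?case using cterm_ends[OF wf V_id_right] by (simp add: cterms.V cterms.Idt)
next
  case (H_id_left t)
  then show ?case using cterm_ends[OF wf H_id_left] path_ends[OF _ wf, of "tdom P t"]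
    by (simp add: cterms.intros paths.Nil)
next
  case (H_id_right t)
  then show ?case using cterm_ends[OF wf H_id_right] path_ends[OF _ wf, of "tdom P t"]
    by (simp add: cterms.intros paths.Nil)
next
  case (interchange t' t u' u)
  then show ?case using cterm_ends[OF wf]
    by (auto elim!: VC_E HC_E intro!: cterms.intros)
next
  case (H_id q p)
  then have "q \<in> paths P" "p \<in> paths P" "pdom q = pcod p" by (auto elim!: HC_E Idt_E)
  then show ?case using H_id by (simp add: cterms.Idt pcomp_paths)
next
  case (V t t' u u')
  then show ?case by (elim VC_E) (simp add: cterms.V)
next
  case (H t t' u u')
  then show ?case by (elim HC_E) (simp add: cterms.H)
next
  case (V_assoc t u v)
  then show ?case by (elim VC_E) (simp add: cterms.V)
next
  case (H_assoc t u v)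
  then show ?case by (elim HC_E) (simp add: cterms.H pcomp_assoc)
qed simp_all

lemma cls_eq_iff:
  assumes "well_formed P" "t \<in> cterms P"
  shows "cls P t = cls P u \<longleftrightarrow> cong P t u"
proof
  assume "cls P t = cls P u"
  then have "cong P u t" using cong.refl[OF assms(2)] unfolding cls_def by blast
  then show "cong P t u" by (rule cong.sym)
next
  assume "cong P t u"
  then have "cong P t v \<longleftrightarrow> cong P u v" for v by (meson cong.sym cong.trans)
  then show "cls P t = cls P u" unfolding cls_def by (intro Collect_cong)
qed

lemma in_cls: "t \<in> cterms P \<Longrightarrow> t \<in> cls P t"
  by (simp add: cls_def cong.refl)

lemma cls_ends:
  assumes "well_formed P" "t \<in> cterms P"
  shows "the_elem (tdom P ` cls P t) = tdom P t" "the_elem (tcod P ` cls P t) = tcod P t"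
proof -
  have eq: "tdom P u = tdom P t \<and> tcod P u = tcod P t" if "u \<in> cls P t" for u
    using cong_cterms[OF assms(1), of t u] that unfolding cls_def by simp
  have "tdom P ` cls P t = (\<lambda>_. tdom P t) ` cls P t" "tcod P ` cls P t = (\<lambda>_. tcod P t) ` cls P t"
    by (simp_all add: eq cong: image_cong)
  then have "tdom P ` cls P t = {tdom P t}" "tcod P ` cls P t = {tcod P t}"
    using in_cls[OF assms(2)] by auto
  then show "the_elem (tdom P ` cls P t) = tdom P t" "the_elem (tcod P ` cls P t) = tcod P t"
    by simp_all
qed

lemma UN2_const:
  assumes "\<And>x y. x \<in> S \<Longrightarrow> y \<in> T \<Longrightarrow> F x y = c" "s \<in> S" "t \<in> T"
  shows "(\<Union>x \<in> S. \<Union>y \<in> T. F x y) = c"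
proof -
  have "(\<Union>x \<in> S. \<Union>y \<in> T. F x y) = (\<Union>x \<in> S. \<Union>y \<in> T. c)"
    by (rule SUP_cong[OF HOL.refl], rule SUP_cong[OF HOL.refl], rule assms(1))
  then show ?thesis using assms(2,3) by auto
qed

lemma cls_V:
  assumes wf: "well_formed P" and "VC t u \<in> cterms P"
  shows "(\<Union>t' \<in> cls P t. \<Union>u' \<in> cls P u. cls P (VC t' u')) = cls P (VC t u)"
proof -
  have tu: "t \<in> cterms P" "u \<in> cterms P" using assms(2) by (auto elim: VC_E)
  have eq: "cls P (VC t' u') = cls P (VC t u)" if "t' \<in> cls P t" "u' \<in> cls P u" for t' u'
    using cong.V[of P t t' u u'] that assms cls_eq_iff[OF wf assms(2), of "VC t' u'"]
    by (simp add: cls_def[of P t] cls_def[of P u])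
  show ?thesis by (rule UN2_const[OF eq in_cls[OF tu(1)] in_cls[OF tu(2)]])
qed

lemma cls_H:
  assumes wf: "well_formed P" and "HC t u \<in> cterms P"
  shows "(\<Union>t' \<in> cls P t. \<Union>u' \<in> cls P u. cls P (HC t' u')) = cls P (HC t u)"
proof -
  have tu: "t \<in> cterms P" "u \<in> cterms P" using assms(2) by (auto elim: HC_E)
  have eq: "cls P (HC t' u') = cls P (HC t u)" if "t' \<in> cls P t" "u' \<in> cls P u" for t' u'
    using cong.H[of P t t' u u'] that assms cls_eq_iff[OF wf assms(2), of "HC t' u'"]
    by (simp add: cls_def[of P t] cls_def[of P u])
  show ?thesis by (rule UN2_const[OF eq in_cls[OF tu(1)] in_cls[OF tu(2)]])
qed

lemma free_simps [simp]:
  "Obj (free_two_cat P) = gobj P" "Mor (free_two_cat P) = paths P"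
  "Cell (free_two_cat P) = cls P ` cterms P"
  "dom1 (free_two_cat P) = pdom" "cod1 (free_two_cat P) = pcod"
  "id1 (free_two_cat P) x = (x, [], x)" "comp1 (free_two_cat P) = pcomp"
  "id2 (free_two_cat P) p = cls P (Idt p)"
  by (simp_all add: free_two_cat_def)

lemma free_cls:
  assumes "well_formed P"
  shows "t \<in> cterms P \<Longrightarrow> dom2 (free_two_cat P) (cls P t) = tdom P t"
    "t \<in> cterms P \<Longrightarrow> cod2 (free_two_cat P) (cls P t) = tcod P t"
    "VC t u \<in> cterms P \<Longrightarrow> vcomp (free_two_cat P) (cls P t) (cls P u) = cls P (VC t u)"
    "HC t u \<in> cterms P \<Longrightarrow> hcomp (free_two_cat P) (cls P t) (cls P u) = cls P (HC t u)"
  by (simp_all only: free_two_cat_def two_cat.simps cls_ends[OF assms] cls_V[OF assms] cls_H[OF assms])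

lemma two_category_free:
  assumes wf: "well_formed P"
  shows "two_category (free_two_cat P)"
proof -
  note ends = cterm_ends[OF wf] and pe = path_ends[OF _ wf]
  have clsI: "cls P t = cls P u" if "cong P t u" for t u
    using cls_eq_iff[OF wf, of t u] cong_cterms[OF wf that] that by simp
  show ?thesis
    apply unfold_locales
    apply (simp_all add: pe paths.Nil pcomp_paths pcomp_assoc)
    by (auto simp: free_cls[OF wf] ends cterms.intros paths.Nil pe pcomp_paths
        simp del: split_paired_All split_paired_Ex
        intro!: imageI clsI cong.V_assoc cong.V_id_left cong.V_id_right cong.H_assoc cong.H_id_left
         cong.H_id_right cong.H_id cong.interchange del: equalityI set_eqI subset_antisym)
qed

lemma well_formed_ex: "well_formed ex_generators"
proof -
  have [simp]: "gdom ex_generators = ex_dom" "gcod ex_generators = ex_cod"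
    "gobj ex_generators = UNIV" "gmor ex_generators = UNIV" by (simp_all add: ex_generators_def)
  have 1: "(obX, [mor_alpha0], obA) \<in> paths ex_generators"
    using paths.Cons[of obX "[]" ex_generators mor_alpha0] by (simp add: paths.Nil)
  have 2: "(obX, [mor_alpha1], obB) \<in> paths ex_generators"
    using paths.Cons[of obX "[]" ex_generators mor_alpha1] by (simp add: paths.Nil)
  have 3: "(obX, [mor_f, mor_alpha0], obB) \<in> paths ex_generators"
    using paths.Cons[of obX "[mor_alpha0]" ex_generators mor_f] 1 by simp
  show ?thesis using 2 3 by (auto simp: well_formed_def ex_generators_def pdom_def pcod_def)
qed
lemma two_simps [simp]:
  "Obj two = {0, 1}" "Mor two = {(0, 0), (0, 1), (1, 1)}" "Cell two = {(0, 0), (0, 1), (1, 1)}"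
  "dom1 two = fst" "cod1 two = snd" "dom2 two e = e" "cod2 two e = e"
  "id1 two i = (i, i)" "comp1 two e' e = (fst e, snd e')" "id2 two e = e"
  "vcomp two e' e = e" "hcomp two e' e = (fst e, snd e')"
  by (simp_all add: two_def locally_discrete_def arrow_cat_def)

lemma two_category_two: "two_category two"
  by unfold_locales auto

context two_category
begin

lemma invertible2_id2: "g \<in> Mor A \<Longrightarrow> invertible2 A (id2 A g)"
  unfolding invertible2_def hom2_def
  using id2_Cell dom2_id2 cod2_id2 vcomp_id2_left[of "id2 A g"] by auto

lemma id2_vcomp_id2: "g \<in> Mor A \<Longrightarrow> id2 A g \<bullet> id2 A g = id2 A g"
  using id2_Cell dom2_id2 vcomp_id2_right[of "id2 A g"] by simp

lemma two_functor_Delta0: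
  assumes "two_category I" "x \<in> Obj A"
  shows "two_functor I A (Delta0 I A x)"
proof -
  interpret I: two_category I by fact
  have "id1 A x \<cdot> id1 A x = id1 A x"
    using comp1_id1_left[of "id1 A x"] id1_Mor cod1_id1 assms(2) by simp
  then show ?thesis
    unfolding two_functor_def Delta0_def hom1_def hom2_def
    using assms(2)
    by (simp add: I.dom1_Obj I.cod1_Obj I.id1_Mor I.comp1_Mor I.dom2_Mor I.cod2_Mor I.id2_Cell
        I.vcomp_Cell I.hcomp_Cell id1_Mor dom1_id1 cod1_id1 id2_Cell dom2_id2 cod2_id2
        id2_vcomp_id2 hcomp_id2)
qed

lemma two_functor_arrow_functor:
  assumes "m \<in> Mor A"
  shows "two_functor two A (arrow_functor A m)"
proof -
  have "id1 A (dom1 A m) \<cdot> id1 A (dom1 A m) = id1 A (dom1 A m)"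
    "id1 A (cod1 A m) \<cdot> id1 A (cod1 A m) = id1 A (cod1 A m)"
    "id1 A (cod1 A m) \<cdot> m = m" "m \<cdot> id1 A (dom1 A m) = m"
    using comp1_id1_left comp1_id1_right assms id1_Mor cod1_id1 dom1_Obj cod1_Obj by metis+
  then show ?thesis
    unfolding two_functor_def arrow_functor_def hom1_def hom2_def
    using assms
    by (simp add: arrow_fmor_def dom1_Obj cod1_Obj id1_Mor dom1_id1 cod1_id1 id2_Cell dom2_id2
        cod2_id2 id2_vcomp_id2 hcomp_id2)
qed

lemma pseudo_natural_id_cone:
  assumes "m \<in> Mor A"
  shows "pseudo_natural two A (id_cone A m)"
proof -
  have 1: "two_functor two A (Delta0 two A (dom1 A m))"
    using two_functor_Delta0 two_category_two dom1_Obj assms by blast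
  have "id1 A (dom1 A m) \<cdot> id1 A (dom1 A m) = id1 A (dom1 A m)"
    "id1 A (cod1 A m) \<cdot> m = m" "m \<cdot> id1 A (dom1 A m) = m"
    using comp1_id1_left comp1_id1_right assms id1_Mor cod1_id1 dom1_Obj by metis+
  then show ?thesis
    using 1 two_functor_arrow_functor[OF assms] assms
    unfolding pseudo_natural_def lax_natural_def Let_def id_cone_def hom1_def hom2_def
    by (simp add: arrow_functor_def arrow_fmor_def Delta0_def dom1_Obj cod1_Obj id1_Mor dom1_id1
        cod1_id1 id2_Cell dom2_id2 cod2_id2 id2_vcomp_id2 hcomp_id2 invertible2_id2)
qed

end

lemma two_category_exA: "two_category exA"
  unfolding exA_def by (rule two_category_free[OF well_formed_ex])

lemma exf_in_Mor: "exf \<in> Mor exA"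
  using paths.Cons[of obA "[]" ex_generators mor_f]
  by (simp add: exA_def exf_def ex_generators_def paths.Nil)

end

(* Between any two parallel 1-morphisms of the example there is exactly one 2-morphism, because
   f alpha0 and alpha1 are the only distinct parallel paths.  In such a 2-category all coherence
   equations hold automatically, every 2-morphism is invertible and lax coincides with pseudo.
   A morphism (h, phi) from a cone mu to id_f is then determined by h alone, which must be mu_0,
   the only morphism to A from its domain, and phi always exists; so (A, id_f) is 2-terminal.
   But post-composition with id_f only reaches cones with mu_1 = f mu_0, and the cone
   (alpha0, alpha1, alpha) is not of this form. *)
theory Submission
  imports Defs
begin

section \<open>Locally chaotic 2-categories\<close>

text \<open>Every hom-category is indiscrete: \<open>full\<close> supplies a 2-morphism between
  parallel morphisms, \<open>thin\<close> makes it unique. An equation of 2-morphisms then reduces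
  to a comparison of boundaries.\<close>

locale locally_chaotic = two_category +
  assumes thin: "\<lbrakk>a \<in> Cell A; b \<in> Cell A; dom2 A a = dom2 A b; cod2 A a = cod2 A b\<rbrakk> \<Longrightarrow> a = b"
    and full: "\<lbrakk>f \<in> Mor A; g \<in> Mor A; dom1 A f = dom1 A g; cod1 A f = cod1 A g\<rbrakk>
      \<Longrightarrow> \<exists>a. a \<in> hom2 A f g"
begin

lemmas typing = dom1_Obj cod1_Obj id1_Mor dom1_id1 cod1_id1 comp1_Mor dom1_comp1 cod1_comp1
  dom2_Mor cod2_Mor dom1_cod2 cod1_cod2 id2_Cell dom2_id2 cod2_id2 vcomp_Cell dom2_vcomp
  cod2_vcomp hcomp_Cell dom2_hcomp cod2_hcomp

definition the_cell where
  "the_cell f g = (SOME a. a \<in> hom2 A f g)"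

lemma the_cell_hom2:
  "\<lbrakk>f \<in> Mor A; g \<in> Mor A; dom1 A f = dom1 A g; cod1 A f = cod1 A g\<rbrakk>
    \<Longrightarrow> the_cell f g \<in> hom2 A f g"
  unfolding the_cell_def using full by (metis someI)

text \<open>The candidate inverse is any 2-morphism backwards, from \<open>full\<close>; both
  composites share their boundary with an identity, so \<open>thin\<close> applies.\<close>

lemma invertible2_all:
  assumes "a \<in> Cell A"
  shows "invertible2 A a"
proof -
  obtain b where b: "b \<in> hom2 A (cod2 A a) (dom2 A a)"
    using full[of "cod2 A a" "dom2 A a"] assms by (auto simp: typing)
  then have "b \<bullet> a = id2 A (dom2 A a)" "a \<bullet> b = id2 A (cod2 A a)"
    using assms by (auto simp: hom2_def typing intro!: thin)
  with b assms show ?thesis unfolding invertible2_def by blast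
qed

section \<open>Coherence deduced from boundaries\<close>

text \<open>Unit, composition and naturality laws each equate two parallel 2-morphisms, so
  components of the right type suffice.\<close>

lemma lax_naturalI:
  assumes "two_category I" "two_functor I A (ldom \<mu>)" "two_functor I A (lcod \<mu>)"
    and "lob \<mu> \<in> extensional (Obj I)" "lmor \<mu> \<in> extensional (Mor I)"
    and lob: "\<And>i. i \<in> Obj I \<Longrightarrow> lob \<mu> i \<in> hom1 A (fob (ldom \<mu>) i) (fob (lcod \<mu>) i)"
    and lmor: "\<And>f. f \<in> Mor I \<Longrightarrow> lmor \<mu> f \<in>
      hom2 A (fmor (lcod \<mu>) f \<cdot> lob \<mu> (dom1 I f)) (lob \<mu> (cod1 I f) \<cdot> fmor (ldom \<mu>) f)"
  shows "lax_natural I A \<mu>"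
proof -
  interpret I: two_category I by fact
  define F G where "F = ldom \<mu>" and "G = lcod \<mu>"
  have F: "two_functor I A F" and G: "two_functor I A G"
    using assms(2,3) by (simp_all add: F_def G_def)
  note lob' = lob[folded F_def G_def, unfolded hom1_def, simplified]
  note lmor' = lmor[folded F_def G_def, unfolded hom2_def, simplified]
  note FG = F[unfolded two_functor_def hom1_def hom2_def, simplified]
    G[unfolded two_functor_def hom1_def hom2_def, simplified]
  note Ityp = I.dom1_Obj I.cod1_Obj I.id1_Mor I.dom1_id1 I.cod1_id1 I.comp1_Mor I.dom1_comp1
    I.cod1_comp1 I.dom2_Mor I.cod2_Mor I.dom1_cod2 I.cod1_cod2
  have id: "lmor \<mu> (id1 I i) = id2 A (lob \<mu> i)" if "i \<in> Obj I" for i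
    using that lob'[of i] lmor'[of "id1 I i"] FG
      comp1_id1_left[of "lob \<mu> i"] comp1_id1_right[of "lob \<mu> i"]
    by (intro thin) (simp_all add: typing Ityp)
  \<comment> \<open>Associativity makes the pasting composable: the lower cell ends at
    \<open>fmor G g \<cdot> (lob \<mu> j \<cdot> fmor F f)\<close>, the upper one starts at
    \<open>(fmor G g \<cdot> lob \<mu> j) \<cdot> fmor F f\<close>, where
    \<open>j = cod1 I f\<close>.\<close>
  have comp: "lmor \<mu> (g \<cdot>\<^bsub>I\<^esub> f) =
      (lmor \<mu> g \<star> id2 A (fmor F f)) \<bullet> (id2 A (fmor G g) \<star> lmor \<mu> f)"
    if "g \<in> Mor I" "f \<in> Mor I" "dom1 I g = cod1 I f" for g f
    using that lob'[of "dom1 I f"] lob'[of "cod1 I f"] lob'[of "cod1 I g"]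
      lmor'[of f] lmor'[of g] lmor'[of "g \<cdot>\<^bsub>I\<^esub> f"] FG
    by (intro thin) (simp_all add: typing Ityp comp1_assoc)
  have nat: "lmor \<mu> (cod2 I a) \<bullet> (fcell G a \<star> id2 A (lob \<mu> (dom1 I (dom2 I a)))) =
      (id2 A (lob \<mu> (cod1 I (dom2 I a))) \<star> fcell F a) \<bullet> lmor \<mu> (dom2 I a)"
    if "a \<in> Cell I" for a
    using that lob'[of "dom1 I (dom2 I a)"] lob'[of "cod1 I (dom2 I a)"]
      lmor'[of "dom2 I a"] lmor'[of "cod2 I a"] FG
    by (intro thin) (simp_all add: typing Ityp)
  show ?thesis
    unfolding lax_natural_def Let_def F_def[symmetric] G_def[symmetric]
    using F G assms(4,5) lob lmor id comp nat by (simp add: F_def G_def)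
qed

lemma modificationI:
  assumes "two_category I" "lax_natural I A (mdom \<phi>)" "lax_natural I A (mcod \<phi>)"
    and "ldom (mcod \<phi>) = ldom (mdom \<phi>)" "lcod (mcod \<phi>) = lcod (mdom \<phi>)"
    and "mob \<phi> \<in> extensional (Obj I)"
    and mob: "\<And>i. i \<in> Obj I \<Longrightarrow> mob \<phi> i \<in> hom2 A (lob (mdom \<phi>) i) (lob (mcod \<phi>) i)"
  shows "modification I A \<phi>"
proof -
  interpret I: two_category I by fact
  note lax = assms(2,3)[unfolded lax_natural_def Let_def two_functor_def hom1_def hom2_def, simplified]
  note mob' = mob[unfolded hom2_def, simplified]
  have "lmor (mcod \<phi>) f \<bullet> (id2 A (fmor (lcod (mdom \<phi>)) f) \<star> mob \<phi> (dom1 I f)) =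
      (mob \<phi> (cod1 I f) \<star> id2 A (fmor (ldom (mdom \<phi>)) f)) \<bullet> lmor (mdom \<phi>) f"
    if "f \<in> Mor I" for f
    using that mob'[of "dom1 I f"] mob'[of "cod1 I f"] lax assms(4,5)
    by (intro thin) (simp_all add: typing I.dom1_Obj I.cod1_Obj)
  then show ?thesis unfolding modification_def Let_def using assms by simp
qed

text \<open>Components agree on \<open>Obj I\<close> by \<open>thin\<close>, and outside it because
  both are extensional.\<close>

lemma modification_eqI:
  assumes "modification I A \<phi>" "modification I A \<psi>" "mdom \<phi> = mdom \<psi>" "mcod \<phi> = mcod \<psi>"
  shows "\<phi> = \<psi>"
proof -
  have "mob \<phi> = mob \<psi>"
    using assms thin unfolding modification_def Let_def hom2_def
    by (intro extensionalityI[of _ "Obj I"]) auto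
  with assms(3,4) show ?thesis by (intro modif.equality) simp_all
qed

section \<open>Lax against pseudo, and invertible modifications\<close>

lemma pseudo_natural_iff: "pseudo_natural I A \<mu> \<longleftrightarrow> lax_natural I A \<mu>"
  unfolding pseudo_natural_def lax_natural_def Let_def hom2_def using invertible2_all by auto

text \<open>This is an equality of records, so every statement about lax-cones transfers to
  pseudo-cones by rewriting.\<close>

lemma Ps_eq_Lax: "Ps I A = Lax I A"
proof -
  have "{\<phi>. modification I A \<phi> \<and> pseudo_natural I A (mdom \<phi>) \<and> pseudo_natural I A (mcod \<phi>)} =
      Collect (modification I A)"
    by (auto simp: pseudo_natural_iff modification_def Let_def)
  moreover have "pseudo_natural I A = lax_natural I A" by (intro ext pseudo_natural_iff)
  ultimately show ?thesis unfolding Ps_def by (simp add: Lax_def)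
qed

lemma modification_vcomp:
  assumes "two_category I" "modification I A \<phi>" "modification I A \<psi>" "mdom \<psi> = mcod \<phi>"
  shows "modification I A (\<psi> \<bullet>\<^bsub>Lax I A\<^esub> \<phi>)"
  using assms
  by (intro modificationI) (auto simp: Lax_def modification_def Let_def hom2_def typing)

lemma modification_id2:
  assumes "two_category I" "lax_natural I A \<mu>"
  shows "modification I A (id2 (Lax I A) \<mu>)"
  using assms
  by (intro modificationI)
    (auto simp: Lax_def lax_natural_def Let_def hom1_def hom2_def typing)

lemma modification_exists:
  assumes "two_category I" "lax_natural I A \<mu>" "lax_natural I A \<nu>"
    and "ldom \<nu> = ldom \<mu>" "lcod \<nu> = lcod \<mu>"
  obtains \<phi> :: "('i, 'j, 'k, 'a, 'b, 'c) modif"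
  where "modification I A \<phi>" "mdom \<phi> = \<mu>" "mcod \<phi> = \<nu>"
proof
  let ?\<phi> = "\<lparr>mdom = \<mu>, mcod = \<nu>, mob = (\<lambda>i \<in> Obj I. the_cell (lob \<mu> i) (lob \<nu> i))\<rparr>"
  show "modification I A ?\<phi>"
    using assms
    by (intro modificationI) (auto simp: lax_natural_def Let_def hom1_def intro!: the_cell_hom2)
qed simp_all

text \<open>Some modification runs backwards, and \<open>modification_eqI\<close> identifies both
  composites with identities. Thus the invertibility demanded of slice morphisms is
  automatic.\<close>

lemma invertible2_Lax:
  assumes "two_category I" "modification I A \<phi>"
  shows "invertible2 (Lax I A) \<phi>"
proof -
  have lax: "lax_natural I A (mdom \<phi>)" "lax_natural I A (mcod \<phi>)"
    "ldom (mcod \<phi>) = ldom (mdom \<phi>)" "lcod (mcod \<phi>) = lcod (mdom \<phi>)"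
    using assms(2) by (simp_all add: modification_def Let_def)
  obtain \<psi> where \<psi>: "modification I A \<psi>" "mdom \<psi> = mcod \<phi>" "mcod \<psi> = mdom \<phi>"
    using modification_exists[OF assms(1) lax(2,1)] lax(3,4) by metis
  have "\<psi> \<bullet>\<^bsub>Lax I A\<^esub> \<phi> = id2 (Lax I A) (mdom \<phi>)"
    by (rule modification_eqI[OF modification_vcomp[OF assms \<psi>(1,2)]
          modification_id2[OF assms(1) lax(1)]]) (simp_all add: Lax_def \<psi>)
  moreover have "\<phi> \<bullet>\<^bsub>Lax I A\<^esub> \<psi> = id2 (Lax I A) (mcod \<phi>)"
    by (rule modification_eqI[OF modification_vcomp[OF assms(1) \<psi>(1) assms(2) \<psi>(3)[symmetric]]
          modification_id2[OF assms(1) lax(2)]]) (simp_all add: Lax_def \<psi>)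
  ultimately show ?thesis
    unfolding invertible2_def hom2_def using assms(2) \<psi> by (auto simp: Lax_def)
qed

text \<open>Only boundaries need checking, and these match up to associativity and the identities
  that form the values of \<open>Delta0\<close> on morphisms.\<close>

lemma lax_natural_lax_comp_Delta1:
  assumes "two_category I" "lax_natural I A \<nu>" "ldom \<nu> = Delta0 I A (cod1 A h)" "h \<in> Mor A"
  shows "lax_natural I A (lax_comp I A \<nu> (Delta1 I A h))"
proof -
  interpret I: two_category I by fact
  show ?thesis
    using assms comp1_id1_left[OF assms(4)] comp1_id1_right[OF assms(4)]
      two_functor_Delta0[OF assms(1), of "dom1 A h"]
    by (intro lax_naturalI)
      (auto simp: lax_comp_def Delta1_def lax_natural_def Let_def hom1_def hom2_def typing
        Delta0_def comp1_assoc I.dom1_Obj I.cod1_Obj two_functor_def)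
qed

end

section \<open>2-terminality in the slice and failure of the universal property\<close>

lemma isomorphic_cats_terminalI:
  assumes "Ob C = {x}" "Ar C = {u}" "dm C u = x" "cd C u = x" "ident C x = u" "cmp C u u = u"
  shows "isomorphic_cats C terminal_cat"
  unfolding isomorphic_cats_def is_cat_iso_def
proof (intro exI conjI)
  show "is_functor C terminal_cat (\<lambda>_. ()) (\<lambda>_. ())"
    "is_functor terminal_cat C (\<lambda>_. x) (\<lambda>_. u)"
    using assms by (simp_all add: is_functor_def terminal_cat_def)
qed (use assms in auto)

context locally_chaotic
begin

text \<open>By \<open>uniq\<close> at most one morphism enters \<open>dom1 A m\<close> from each
  object. Each hom-category of the slice into the cone then has one object, as the modification is
  unique too, and one arrow by \<open>thin\<close>.\<close>

lemma two_terminal_id_cone: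
  assumes m: "m \<in> Mor A"
    and uniq: "\<And>h k. \<lbrakk>h \<in> Mor A; k \<in> Mor A; cod1 A h = dom1 A m; cod1 A k = dom1 A m;
      dom1 A h = dom1 A k\<rbrakk> \<Longrightarrow> h = k"
  shows "two_terminal (pseudo_slice two A (Lax two A) (arrow_functor A m)) (dom1 A m, id_cone A m)"
proof -
  let ?F = "arrow_functor A m" and ?T = "Lax two A" and ?l = "id_cone A m" and ?a = "dom1 A m"
  let ?S = "pseudo_slice two A ?T ?F"
  have l: "lax_natural two A ?l" using pseudo_natural_id_cone[OF m] by (simp add: pseudo_natural_iff)
  have ends: "ldom ?l = Delta0 two A ?a" "lcod ?l = ?F" by (simp_all add: id_cone_def)
  have obj: "(?a, ?l) \<in> slice_obj two A ?T ?F"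
    using m l ends by (simp add: slice_obj_def cones_over_def hom1_def Lax_def dom1_Obj)
  have "isomorphic_cats (hom_cat ?S (x, \<mu>) (?a, ?l)) terminal_cat"
    if "(x, \<mu>) \<in> slice_obj two A ?T ?F" for x \<mu>
  proof -
    have x: "x \<in> Obj A" and \<mu>: "lax_natural two A \<mu>" "ldom \<mu> = Delta0 two A x" "lcod \<mu> = ?F"
      using that by (auto simp: slice_obj_def cones_over_def hom1_def Lax_def)
    \<comment> \<open>The component of \<open>id_cone\<close> at 0 is an identity, so composing the
      cone with \<open>h\<close> reproduces the component of \<open>\<mu>\<close> at 0.\<close>
    define h where "h = lob \<mu> 0"
    have "\<forall>i\<in>Obj two. lob \<mu> i \<in> hom1 A (fob (ldom \<mu>) i) (fob (lcod \<mu>) i)"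
      using \<mu>(1) unfolding lax_natural_def Let_def by blast
    then have h: "h \<in> Mor A" "dom1 A h = x" "cod1 A h = ?a"
      by (simp_all add: h_def \<mu> hom1_def Delta0_def arrow_functor_def)
    let ?lh = "lax_comp two A ?l (Delta1 two A h)"
    have lh: "lax_natural two A ?lh"
      by (rule lax_natural_lax_comp_Delta1[OF two_category_two l]) (simp_all add: ends h)
    have lh_ends: "ldom ?lh = ldom \<mu>" "lcod ?lh = lcod \<mu>"
      by (simp_all add: lax_comp_def Delta1_def h \<mu> ends)
    \<comment> \<open>At 1 the composite has component \<open>m \<cdot> h\<close>, which may differ
      from that of \<open>\<mu>\<close>; a 2-morphism still links them.\<close>
    obtain \<phi> where \<phi>: "modification two A \<phi>" "mdom \<phi> = ?lh" "mcod \<phi> = \<mu>"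
      using modification_exists[OF two_category_two lh \<mu>(1)] lh_ends by metis
    let ?m = "\<lparr>sdom = (x, \<mu>), scod = (?a, ?l), smor = h, smod = \<phi>\<rparr>"
    let ?b = "\<lparr>cdom = ?m, ccod = ?m, ccell = id2 A h\<rparr>"
    have mS: "?m \<in> slice_hom two A ?T ?F"
      using that obj h \<phi> invertible2_Lax[OF two_category_two \<phi>(1)]
      by (simp add: slice_hom_def hom1_def hom2_def Lax_def)
    have only_mor: "n = ?m"
      if n: "n \<in> slice_hom two A ?T ?F" "sdom n = (x, \<mu>)" "scod n = (?a, ?l)" for n
    proof (rule slice_mor.equality)
      have *: "smor n \<in> Mor A" "dom1 A (smor n) = x" "cod1 A (smor n) = ?a"
        "modification two A (smod n)" "mcod (smod n) = \<mu>"
        "mdom (smod n) = lax_comp two A ?l (Delta1 two A (smor n))"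
        using n by (auto simp: slice_hom_def hom1_def hom2_def Lax_def)
      then show "smor n = smor ?m" using uniq[of "smor n" h] h by simp
      then show "smod n = smod ?m" using * \<phi> modification_eqI[of two "smod n" \<phi>] by simp
    qed (use n in simp_all)
    have bS: "?b \<in> slice_two_hom two A ?T ?F"
    proof -
      let ?\<chi> = "\<phi> \<bullet>\<^bsub>?T\<^esub> (id2 ?T ?l \<star>\<^bsub>?T\<^esub> Delta2 two A (id2 A h))"
      \<comment> \<open>Whiskering identities gives an identity, so the slice condition on
        \<open>?b\<close> reduces to \<open>\<phi> = \<phi>\<close>.\<close>
      have mid: "id2 ?T ?l \<star>\<^bsub>?T\<^esub> Delta2 two A (id2 A h) = id2 ?T ?lh"
      proof -
        have "lob ?l i \<in> Mor A \<and> dom1 A (lob ?l i) = ?a" if "i \<in> Obj two" for i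
          using m that by (auto simp: id_cone_def typing)
        then have "(\<lambda>i \<in> Obj two. id2 A (lob ?l i) \<star> id2 A h) = (\<lambda>i \<in> Obj two. id2 A (lob ?l i \<cdot> h))"
          using h by (intro restrict_ext) (metis hcomp_id2)
        with h show ?thesis
          by (simp add: Lax_def Delta2_def lax_comp_def Delta1_def typing del: two_simps cong: restrict_cong)
      qed
      have "?\<chi> = \<phi>"
        unfolding mid
        by (rule modification_eqI[OF modification_vcomp[OF two_category_two
                modification_id2[OF two_category_two lh] \<phi>(1)] \<phi>(1)])
          (simp_all add: Lax_def \<phi>)
      then show ?thesis
        using mS h by (simp add: slice_two_hom_def hom2_def typing)
    qed
    have only_cell: "c = ?b" if c: "c \<in> slice_two_hom two A ?T ?F" "cdom c = ?m" "ccod c = ?m" for c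
    proof (rule slice_cell.equality)
      have "ccell c \<in> hom2 A h h" using c by (auto simp: slice_two_hom_def)
      then show "ccell c = ccell ?b" using h by (auto simp: hom2_def typing intro!: thin)
    qed (use c in simp_all)
    have Ar: "{c \<in> slice_two_hom two A ?T ?F. cdom c \<in> {?m} \<and> ccod c \<in> {?m}} = {?b}"
    proof (intro equalityI subsetI)
      show "c \<in> {?b}" if "c \<in> {c \<in> slice_two_hom two A ?T ?F. cdom c \<in> {?m} \<and> ccod c \<in> {?m}}" for c
        using that only_cell[of c] by blast
    qed (use bS in simp)
    have Ob: "hom1 ?S (x, \<mu>) (?a, ?l) = {?m}"
    proof (intro equalityI subsetI)
      show "n \<in> {?m}" if "n \<in> hom1 ?S (x, \<mu>) (?a, ?l)" for n
        using that only_mor[of n] by (simp add: hom1_def pseudo_slice_def)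
    qed (use mS in \<open>simp add: hom1_def pseudo_slice_def\<close>)
    have S: "Cell ?S = slice_two_hom two A ?T ?F" "dom2 ?S = cdom" "cod2 ?S = ccod"
      by (simp_all add: pseudo_slice_def)
    show ?thesis
    proof (rule isomorphic_cats_terminalI[of _ ?m ?b])
      show "Ob (hom_cat ?S (x, \<mu>) (?a, ?l)) = {?m}" by (simp add: hom_cat_def Ob)
      show "Ar (hom_cat ?S (x, \<mu>) (?a, ?l)) = {?b}"
        unfolding hom_cat_def cat.simps Ob S by (rule Ar)
    qed (use h in \<open>simp_all add: hom_cat_def pseudo_slice_def id2_vcomp_id2\<close>)
  qed
  then show ?thesis
    using obj unfolding two_terminal_def by (simp add: pseudo_slice_def split_paired_all)
qed

text \<open>Post-composition would have to be surjective on cones from \<open>x\<close>, but it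
  yields only cones whose component at 1 factors through \<open>m\<close>; a cone with components
  \<open>h\<close> and \<open>q\<close> is missed.\<close>

lemma not_lax_limit_id_cone:
  assumes m: "m \<in> Mor A" and h: "h \<in> hom1 A x (dom1 A m)" and q: "q \<in> hom1 A x (cod1 A m)"
    and no: "\<And>k. k \<in> hom1 A x (dom1 A m) \<Longrightarrow> q \<noteq> m \<cdot> k"
  shows "\<not> lax_limit two A (arrow_functor A m) (dom1 A m) (id_cone A m)"
proof
  let ?F = "arrow_functor A m" and ?T = "Lax two A" and ?l = "id_cone A m"
  assume lim: "lax_limit two A ?F (dom1 A m) ?l"
  have x: "x \<in> Obj A" using h dom1_Obj by (auto simp: hom1_def)
  define c where "c = (\<lambda>i \<in> Obj two. if i = 0 then h else q)"
  \<comment> \<open>At \<open>(0, 1)\<close> the chosen 2-morphism fills the triangle from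
    \<open>m \<cdot> h\<close> to \<open>q\<close>; at the identities of \<open>two\<close>,
    \<open>thin\<close> forces it to be an identity.\<close>
  define \<mu> where "\<mu> = \<lparr>ldom = Delta0 two A x, lcod = ?F, lob = c,
     lmor = (\<lambda>e \<in> Mor two. the_cell (fmor ?F e \<cdot> c (fst e)) (c (snd e) \<cdot> id1 A x))\<rparr>"
  have "lax_natural two A \<mu>"
    by (rule lax_naturalI[OF two_category_two])
      (use two_functor_Delta0[OF two_category_two x] two_functor_arrow_functor[OF m] h q m x in
        \<open>auto simp: \<mu>_def c_def Delta0_def arrow_functor_def arrow_fmor_def hom1_def typing
          intro!: the_cell_hom2\<close>)
  then have "\<mu> \<in> Ob (hom_cat ?T (Delta0 two A x) ?F)"
    by (simp add: hom_cat_def hom1_def Lax_def \<mu>_def)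
  then obtain k where k: "k \<in> hom1 A x (dom1 A m)" "postcomp_ob two A ?T ?l k = \<mu>"
    using lim x unfolding lax_limit_def limit_wrt_def is_cat_iso_def is_functor_def
    by (simp add: hom_cat_def) metis
  have "lob (postcomp_ob two A ?T ?l k) 1 = m \<cdot> k"
    by (simp add: postcomp_ob_def Lax_def lax_comp_def id_cone_def Delta1_def)
  with k no show False by (simp add: \<mu>_def c_def)
qed

end

section \<open>The 2-category of the example is locally chaotic\<close>

text \<open>The generating graph is acyclic: the seven listed paths are closed under prepending a
  composable generator, and each is built by \<open>Cons\<close> from an empty path.\<close>

lemma paths_ex:
  "paths ex_generators = {(obX, [], obX), (obA, [], obA), (obB, [], obB), (obX, [mor_alpha0], obA),
     (obX, [mor_alpha1], obB), (obA, [mor_f], obB), (obX, [mor_f, mor_alpha0], obB)}"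
  (is "_ = ?P")
proof
  have "(x, es, y) \<in> ?P" if "(x, es, y) \<in> paths ex_generators" for x es y
    using that
  proof induction
    case (Nil x)
    then show ?case by (cases x) auto
  next
    case (Cons x es e)
    have "(x, es, ex_dom e) \<in> ?P" using Cons.IH by (simp add: ex_generators_def)
    then have "(x, e # es, ex_cod e) \<in> ?P" by (cases e) auto
    then show ?case by (simp add: ex_generators_def)
  qed
  then show "paths ex_generators \<subseteq> ?P" by (intro subsetI) (metis prod_cases3)
next
  have [simp]: "gdom ex_generators = ex_dom" "gcod ex_generators = ex_cod"
    "gobj ex_generators = UNIV" "gmor ex_generators = UNIV" by (simp_all add: ex_generators_def)
  have Nil: "(x, [], x) \<in> paths ex_generators" for x by (simp add: paths.Nil)
  have Cons: "(x, e # es, ex_cod e) \<in> paths ex_generators"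
    if "(x, es, ex_dom e) \<in> paths ex_generators" for x e es
    using paths.Cons[of x es ex_generators e] that by simp
  show "?P \<subseteq> paths ex_generators"
    using Nil Cons[of obX "[]" mor_alpha0] Cons[of obX "[]" mor_alpha1] Cons[of obA "[]" mor_f]
      Cons[of obX "[mor_alpha0]" mor_f] by simp
qed

text \<open>These two facts show that a non-identity 2-morphism, which lives between
  \<open>obX\<close> and \<open>obB\<close>, can be whiskered only with identities.\<close>

lemma paths_into_X: "p \<in> paths ex_generators \<Longrightarrow> pcod p = obX \<Longrightarrow> p = (obX, [], obX)"
  and paths_from_B: "p \<in> paths ex_generators \<Longrightarrow> pdom p = obB \<Longrightarrow> p = (obB, [], obB)"
  unfolding paths_ex by auto

section \<open>Normal forms of 2-morphism terms\<close>

text \<open>A chosen term for each pair of parallel paths; the last branch is meaningful only for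
  the pair from \<open>mor_alpha1\<close> back to the composite path.\<close>

definition canon where
  "canon p q = (if p = q then Idt p else if q = (obX, [mor_alpha1], obB) then Gen cell_alpha
     else Inv cell_alpha)"

lemma ex_gen_simps [simp]:
  "gcell ex_generators = UNIV" "ginv ex_generators = UNIV"
  "gdom2 ex_generators c = (obX, [mor_f, mor_alpha0], obB)"
  "gcod2 ex_generators c = (obX, [mor_alpha1], obB)"
  by (simp_all add: ex_generators_def)

lemma canon_refl: "canon p p = Idt p"
  by (simp add: canon_def)

abbreviation parallel where
  "parallel p q \<equiv> p \<in> paths ex_generators \<and> q \<in> paths ex_generators \<and>
    pdom p = pdom q \<and> pcod p = pcod q"

text \<open>Going through the list of paths, only the pair of ends \<open>obX\<close>,
  \<open>obB\<close> admits two distinct paths.\<close>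

lemma parallel_cases:
  assumes "parallel p q"
  obtains "p = q" | "p = (obX, [mor_f, mor_alpha0], obB)" "q = (obX, [mor_alpha1], obB)"
    | "p = (obX, [mor_alpha1], obB)" "q = (obX, [mor_f, mor_alpha0], obB)"
proof -
  have "\<forall>p \<in> paths ex_generators. \<forall>q \<in> paths ex_generators.
      pdom p = pdom q \<and> pcod p = pcod q \<longrightarrow> p = q \<or>
      p = (obX, [mor_f, mor_alpha0], obB) \<and> q = (obX, [mor_alpha1], obB) \<or>
      p = (obX, [mor_alpha1], obB) \<and> q = (obX, [mor_f, mor_alpha0], obB)"
    unfolding paths_ex by simp
  with assms that show thesis by blast
qed

lemma canon_cterms:
  assumes "parallel p q"
  shows "canon p q \<in> cterms ex_generators"
    and "tdom ex_generators (canon p q) = p" and "tcod ex_generators (canon p q) = q"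
  by (cases rule: parallel_cases[OF assms]; use assms in \<open>simp add: canon_def cterms.intros\<close>)+

lemma canon_V:
  assumes "parallel p q" "parallel q r"
  shows "cong ex_generators (VC (canon q r) (canon p q)) (canon p r)"
proof -
  note c = canon_cterms[OF assms(1)] canon_cterms[OF assms(2)]
  show ?thesis
  proof (cases "p = q \<or> q = r")
    case True
    then show ?thesis
      using cong.V_id_left[OF c(1)] cong.V_id_right[OF c(4)] c
      by (auto simp: canon_refl)
  next
    \<comment> \<open>Two non-identity steps force \<open>r = p\<close>, so \<open>alpha\<close>
      meets its inverse, in one order or the other.\<close>
    case False
    then show ?thesis
      using cong.Inv_left[of cell_alpha ex_generators] cong.Inv_right[of cell_alpha ex_generators]
      by (cases rule: parallel_cases[OF assms(1)]; cases rule: parallel_cases[OF assms(2)])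
        (simp_all add: canon_def)
  qed
qed

lemma canon_H:
  assumes "parallel p p'" "parallel q q'" "pdom p = pcod q"
  shows "cong ex_generators (HC (canon p p') (canon q q')) (canon (pcomp p q) (pcomp p' q'))"
proof -
  note c = canon_cterms[OF assms(1)] canon_cterms[OF assms(2)]
  consider "p = p'" "q = q'" | "p \<noteq> p'" | "q \<noteq> q'" by blast
  then show ?thesis
  proof cases
    case 1
    then show ?thesis
      using assms cong.H_id[of p q ex_generators]
      by (simp add: canon_refl cterms.intros)
  next
    \<comment> \<open>A non-identity left factor starts at \<open>obX\<close>, where only the empty
      path arrives, so the right factor is a unit. The last case is the mirror image at
      \<open>obB\<close>.\<close>
    case 2
    then have "pdom p = obX" by (cases rule: parallel_cases[OF assms(1)]) simp_all
    then have "q = (obX, [], obX)" "q' = (obX, [], obX)"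
      using assms paths_into_X by simp_all
    then show ?thesis
      using cong.H_id_right[OF c(1)] c \<open>pdom p = obX\<close> assms
      by (simp add: canon_refl)
  next
    case 3
    then have "pcod q = obB" by (cases rule: parallel_cases[OF assms(2)]) simp_all
    then have "p = (obB, [], obB)" "p' = (obB, [], obB)"
      using assms paths_from_B by simp_all
    then show ?thesis
      using cong.H_id_left[OF c(4)] c \<open>pcod q = obB\<close> assms
      by (simp add: canon_refl)
  qed
qed

text \<open>Induction on terms: canonical terms are closed under both compositions up to congruence.
  A term is thus determined by its boundary, which is the source of \<open>thin\<close>.\<close>

lemma cong_canon:
  assumes "t \<in> cterms ex_generators"
  shows "cong ex_generators t (canon (tdom ex_generators t) (tcod ex_generators t))"
  using assms
proof induction
  case (Gen c)
  then show ?case by (cases c) (simp add: canon_def cong.refl cterms.Gen)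
next
  case (Inv c)
  then show ?case by (cases c) (simp add: canon_def cong.refl cterms.Inv)
next
  case (Idt p)
  then show ?case by (simp add: canon_def cong.refl cterms.Idt)
next
  case (V t u)
  then show ?case
    using cterm_ends[OF well_formed_ex V(1)] cterm_ends[OF well_formed_ex V(2)]
    by (auto intro!: cong.trans[OF cong.V canon_V] cterms.V)
next
  case (H t u)
  then show ?case
    using cterm_ends[OF well_formed_ex H(1)] cterm_ends[OF well_formed_ex H(2)]
    by (auto intro!: cong.trans[OF cong.H canon_H] cterms.H)
qed

interpretation exA: locally_chaotic exA
proof -
  interpret two_category exA by (rule two_category_exA)
  note [simp] = free_cls(1,2)[OF well_formed_ex]
  show "locally_chaotic exA"
  proof unfold_locales
    fix a b
    assume ab: "a \<in> Cell exA" "b \<in> Cell exA" "dom2 exA a = dom2 exA b" "cod2 exA a = cod2 exA b"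
    then obtain t u where tu: "a = cls ex_generators t" "b = cls ex_generators u"
      "t \<in> cterms ex_generators" "u \<in> cterms ex_generators"
      by (auto simp: exA_def)
    have "cong ex_generators t u"
      using cong_canon[OF tu(3)] cong_canon[OF tu(4)] ab tu
      by (auto simp: exA_def intro: cong.trans cong.sym)
    then show "a = b" using tu cls_eq_iff[OF well_formed_ex tu(3)] by simp
  next
    fix p q
    assume "p \<in> Mor exA" "q \<in> Mor exA" "dom1 exA p = dom1 exA q" "cod1 exA p = cod1 exA q"
    then have "parallel p q" by (simp add: exA_def)
    from canon_cterms[OF this] have "cls ex_generators (canon p q) \<in> hom2 exA p q"
      by (simp add: exA_def hom2_def)
    then show "\<exists>a. a \<in> hom2 exA p q" ..
  qed
qed

theorem mainTheorem18:
  shows "two_terminal (pseudo_slice_lax_cones two exA (arrow_functor exA exf)) (obA, id_cone exA exf)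
       \<and> two_terminal (pseudo_slice_pseudo_cones two exA (arrow_functor exA exf)) (obA, id_cone exA exf)
       \<and> \<not> lax_limit two exA (arrow_functor exA exf) obA (id_cone exA exf)
       \<and> \<not> pseudo_limit two exA (arrow_functor exA exf) obA (id_cone exA exf)"
proof -
  have exf: "dom1 exA exf = obA" "cod1 exA exf = obB" by (simp_all add: exA_def exf_def)
  \<comment> \<open>Uniqueness of morphisms into \<open>obA\<close> is read off the list of paths:
    the empty path and \<open>mor_alpha0\<close> have different sources.\<close>
  have "two_terminal (pseudo_slice two exA (Lax two exA) (arrow_functor exA exf))
      (dom1 exA exf, id_cone exA exf)"
    by (rule exA.two_terminal_id_cone[OF exf_in_Mor]) (auto simp: exf_def exA_def paths_ex)
  \<comment> \<open>The missed cone has components \<open>mor_alpha0\<close> and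
    \<open>mor_alpha1\<close>. The only path from \<open>obX\<close> to \<open>obA\<close> is
    \<open>mor_alpha0\<close>, and its composite with \<open>exf\<close> is a list of length two,
    hence not \<open>mor_alpha1\<close>.\<close>
  moreover have "\<not> lax_limit two exA (arrow_functor exA exf) (dom1 exA exf) (id_cone exA exf)"
    by (rule exA.not_lax_limit_id_cone[OF exf_in_Mor,
          of "(obX, [mor_alpha0], obA)" obX "(obX, [mor_alpha1], obB)"])
      (auto simp: hom1_def exA_def paths_ex exf_def pcomp_def)
  ultimately show ?thesis
    by (simp add: exf pseudo_slice_lax_cones_def pseudo_slice_pseudo_cones_def lax_limit_def
        pseudo_limit_def exA.Ps_eq_Lax)
qed

end
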